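(* Let $\rho$ be a finite signature and $A$ a finite set. Suppose that $P$ is an isomorphism-invariant property of structures from $\mathrm{Struct}^\rho_A$ and that $\Gamma\in\mathcal{L}^\rho_A$ is an isomorphism-invariant formula such that a structure $\mathbf{A}\in\mathrm{Struct}^\rho_A$ satisfies $P$ exactly when $\mathbf{A}\models\Gamma$. Then there exists a polynomial $g\in\mathbb{Z}[Z^\rho_A]$ with integer coefficients such that for every $\mathbf{A}\in\mathrm{Struct}^\rho_A$, the structure $\mathbf{A}$ satisfies $P$ if and only if the integer obtained from $g$ by substituting, for each $\psi\in\mathrm{IsoStr}^\rho_A$, the count $$\left|\{\mathbf{B}\in\psi:\mathbf{B}\le\mathbf{A}\}\right|$$ for the variable $z_\psi$ is strictly positive. Moreover, $g$ can be chosen so that every variable $z_\psi$ which appears to a positive power in a monomial of $g$ with nonzero coefficient satisfies $\|\psi\|\le c(\Gamma)$, where $c(\Gamma)$ is the complexity of $\Gamma$.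
   Context: A finite signature is a functor $\rho\colon\mathscr{I}\to\mathbf{Fun}(\mathbf{Set},\mathbf{Set})$ where $\mathscr{I}$ is a category with finitely many objects and finitely many morphisms and where, for each object $N$ of $\mathscr{I}$ and each finite set $A$, the set $\rho_A(N):=\rho(N)(A)$ is finite. For a morphism $\nu\colon N_1\to N_2$ of $\mathscr{I}$ write $\rho_A(\nu):=\rho(\nu)_A\colon\rho_A(N_1)\to\rho_A(N_2)$, and for a function $h\colon A\to B$ write $\rho_h(N):=\rho(N)(h)\colon\rho_A(N)\to\rho_B(N)$. A structure of signature $\rho$ on $A$ is a pair $\mathbf{A}=(A,F)$ where $F$ assigns to each object $N$ of $\mathscr{I}$ a subset $F(N)\subseteq\rho_A(N)$ such that for every morphism $\nu\colon N_1\to N_2$ of $\mathscr{I}$ the image of $F(N_1)$ under $\rho_A(\nu)$ is contained in $F(N_2)$. The set of all such structures is $\mathrm{Struct}^\rho_A$. For $\mathbf{B}=(A,F_2)$ and $\mathbf{A}=(A,F_1)$ in $\mathrm{Struct}^\rho_A$, $\mathbf{B}\le\mathbf{A}$ ($\mathbf{B}$ is a substructure of $\mathbf{A}$) means $F_2(N)\subseteq F_1(N)$ for all $N$. The magnitude of $\mathbf{A}=(A,F)$ is $\|\mathbf{A}\|:=\sum_{N}|F(N)|$. $X^\rho_A:=\bigcup_{N\in\mathrm{Ob}(\mathscr{I})}\{x_{N,a}: a\in\rho_A(N)\}$ is a set of variables. For $\mathbf{A}=(A,F)\in\mathrm{Struct}^\rho_A$ let $y_{\mathbf{A}}:=\prod_{N}\prod_{a\in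 F(N)}x_{N,a}$, and let $\mathrm{Pol}^\rho_A$ be the subring of $\mathbb{Z}[X^\rho_A]$ generated by all $y_{\mathbf{A}}$, $\mathbf{A}\in\mathrm{Struct}^\rho_A$. The group $\Sigma_A$ of permutations of $A$ acts on $\mathbb{Z}[X^\rho_A]$ by ring automorphisms with $\upsilon(\sigma)(x_{N,a}):=x_{N,\rho_\sigma(N)(a)}$, and $\mathrm{SymPol}^\rho_A$ is the set of $p\in\mathrm{Pol}^\rho_A$ with $\upsilon(\sigma)(p)=p$ for all $\sigma\in\Sigma_A$. $\Sigma_A$ acts on $\mathrm{Struct}^\rho_A$ by $\zeta(\sigma)(A,F):=(A,F')$ with $F'(N)=\rho_\sigma(N)(F(N))$; $\mathrm{IsoStr}^\rho_A$ is the set of orbits, $\|\psi\|:=\|\mathbf{A}\|$ for any $\mathbf{A}\in\psi\in\mathrm{IsoStr}^\rho_A$, and $Z^\rho_A:=\{z_\psi:\psi\in\mathrm{IsoStr}^\rho_A\}$ is a set of variables. The kindred language $\mathcal{L}^\rho_A$ is the negation-free language whose formulae are built from atoms $\gamma(N,a)$ ($N\in\mathrm{Ob}(\mathscr{I})$, $a\in\rho_A(N)$) by disjunction $\Gamma_1\vee\Gamma_2$, conjunction $\Gamma_1\wedge\Gamma_2$, and quantification $\exists_{a\in\rho_A(N)}\Gamma'(N,a)$ and $\forall_{a\in\rho_A(N)}\Gamma'(N,a)$ over arguments of formulae. For $\mathbf{A}=(A,F)$, $\mathbf{A}\models\Gamma$ means that the sentence obtained by reading each $\gamma(N,a)$ as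 "$a\in F(N)$" holds. The polynomial realization $\xi\colon\mathcal{L}^\rho_A\to\mathbb{Z}[X^\rho_A]$ is defined by $\xi(\gamma(N,a))=x_{N,a}$, $\xi(\Gamma_1\vee\Gamma_2)=\xi(\Gamma_1)+\xi(\Gamma_2)$, $\xi(\Gamma_1\wedge\Gamma_2)=\xi(\Gamma_1)\xi(\Gamma_2)$, $\xi(\exists_{a\in\rho_A(N)}\Gamma'(N,a))=\sum_{a\in\rho_A(N)}\xi(\Gamma'(N,a))$, $\xi(\forall_{a\in\rho_A(N)}\Gamma'(N,a))=\prod_{a\in\rho_A(N)}\xi(\Gamma'(N,a))$. A formula $\Gamma$ is isomorphism-invariant when $\xi(\Gamma)\in\mathrm{SymPol}^\rho_A$. A property $P$ of structures from $\mathrm{Struct}^\rho_A$ is isomorphism-invariant when there is an isomorphism-invariant $\Gamma\in\mathcal{L}^\rho_A$ such that $\mathbf{A}$ satisfies $P$ exactly when $\mathbf{A}\models\Gamma$. Complexity: write $\Gamma$ in disjunctive normal form $\bigvee_{i=1}^m\bigwedge_{j=1}^{n_i}\gamma(N_{ij},a_{ij})$ (replacing quantifiers over the finite sets $\rho_A(N)$ by finite disjunctions and conjunctions, and distributing conjunctions over disjunctions), and remove repeated atoms within each conjunction. Then $c(\Gamma):=\max_{1\le i\le m}n_i$ (taken to be $0$ if $m=0$). *)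

theory Defs
  imports
    "HOL-Library.Poly_Mapping"
    "HOL-Library.FuncSet"
    "HOL-Algebra.Group_Action"
begin

section \<open>Finite signatures\<close>

record ('o, 'm) category =
  obj :: "'o set"
  arr :: "'m set"
  src :: "'m \<Rightarrow> 'o"
  tgt :: "'m \<Rightarrow> 'o"
  ident :: "'o \<Rightarrow> 'm"
  cmp :: "'m \<Rightarrow> 'm \<Rightarrow> 'm"  \<comment> \<open>\<open>cmp C \<nu> \<mu>\<close> is \<open>\<nu> \<circ> \<mu>\<close>: first \<open>\<mu>\<close>, then \<open>\<nu>\<close>\<close>

locale category =
  fixes C :: "('o, 'm, 'z) category_scheme"
  assumes src_obj: "\<nu> \<in> arr C \<Longrightarrow> src C \<nu> \<in> obj C"
    and tgt_obj: "\<nu> \<in> arr C \<Longrightarrow> tgt C \<nu> \<in> obj C"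
    and ident_arr: "N \<in> obj C \<Longrightarrow> ident C N \<in> arr C"
    and src_ident: "N \<in> obj C \<Longrightarrow> src C (ident C N) = N"
    and tgt_ident: "N \<in> obj C \<Longrightarrow> tgt C (ident C N) = N"
    and cmp_arr: "\<lbrakk>\<mu> \<in> arr C; \<nu> \<in> arr C; src C \<nu> = tgt C \<mu>\<rbrakk> \<Longrightarrow> cmp C \<nu> \<mu> \<in> arr C"
    and src_cmp: "\<lbrakk>\<mu> \<in> arr C; \<nu> \<in> arr C; src C \<nu> = tgt C \<mu>\<rbrakk> \<Longrightarrow> src C (cmp C \<nu> \<mu>) = src C \<mu>"
    and tgt_cmp: "\<lbrakk>\<mu> \<in> arr C; \<nu> \<in> arr C; src C \<nu> = tgt C \<mu>\<rbrakk> \<Longrightarrow> tgt C (cmp C \<nu> \<mu>) = tgt C \<nu>"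
    and cmp_ident_right: "\<nu> \<in> arr C \<Longrightarrow> cmp C \<nu> (ident C (src C \<nu>)) = \<nu>"
    and cmp_ident_left: "\<nu> \<in> arr C \<Longrightarrow> cmp C (ident C (tgt C \<nu>)) \<nu> = \<nu>"
    and cmp_assoc: "\<lbrakk>\<kappa> \<in> arr C; \<mu> \<in> arr C; \<nu> \<in> arr C; src C \<mu> = tgt C \<kappa>; src C \<nu> = tgt C \<mu>\<rbrakk>
      \<Longrightarrow> cmp C \<nu> (cmp C \<mu> \<kappa>) = cmp C (cmp C \<nu> \<mu>) \<kappa>"

text \<open>
  The category of sets is modelled by all subsets of a type, with the extensional functions
  \<open>A \<rightarrow>\<^sub>E B\<close> as the morphisms from \<open>A\<close> to \<open>B\<close>. Arguments and values of a set functor live in two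
  types \<open>'a\<close> and \<open>'b\<close>, since for instance the values of \<open>A \<mapsto> A \<times> A\<close> are not subsets of \<open>'a\<close>.
\<close>

locale set_functor =
  fixes Fo :: "'a set \<Rightarrow> 'b set"
    and Fm :: "'a set \<Rightarrow> 'a set \<Rightarrow> ('a \<Rightarrow> 'a) \<Rightarrow> 'b \<Rightarrow> 'b"
  assumes map_hom: "h \<in> A \<rightarrow>\<^sub>E B \<Longrightarrow> Fm A B h \<in> Fo A \<rightarrow>\<^sub>E Fo B"
    and map_ident: "Fm A A (\<lambda>x\<in>A. x) = (\<lambda>x\<in>Fo A. x)"
    and map_compose: "\<lbrakk>h \<in> A \<rightarrow>\<^sub>E B; k \<in> B \<rightarrow>\<^sub>E D\<rbrakk>
      \<Longrightarrow> Fm A D (compose A k h) = compose (Fo A) (Fm B D k) (Fm A B h)"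

locale natural_transformation =
  F: set_functor Fo Fm + G: set_functor Go Gm
  for Fo :: "'a set \<Rightarrow> 'b set" and Fm and Go :: "'a set \<Rightarrow> 'b set" and Gm +
  fixes \<eta> :: "'a set \<Rightarrow> 'b \<Rightarrow> 'b"
  assumes component: "\<eta> A \<in> Fo A \<rightarrow>\<^sub>E Go A"
    and naturality: "h \<in> A \<rightarrow>\<^sub>E B
      \<Longrightarrow> compose (Fo A) (\<eta> B) (Fm A B h) = compose (Fo A) (Gm A B h) (\<eta> A)"

text \<open>
  \<open>rel_obj \<rho> N A\<close> is \<open>\<rho>\<^sub>A(N)\<close>, \<open>rel_fun \<rho> N A B h\<close> is \<open>\<rho>\<^sub>h(N)\<close> for \<open>h : A \<rightarrow> B\<close>, and
  \<open>rel_nat \<rho> \<nu> A\<close> is \<open>\<rho>\<^sub>A(\<nu>)\<close>. The index category consists of the inherited fields.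
\<close>

record ('o, 'm, 'a, 'b) signature = "('o, 'm) category" +
  rel_obj :: "'o \<Rightarrow> 'a set \<Rightarrow> 'b set"
  rel_fun :: "'o \<Rightarrow> 'a set \<Rightarrow> 'a set \<Rightarrow> ('a \<Rightarrow> 'a) \<Rightarrow> 'b \<Rightarrow> 'b"
  rel_nat :: "'m \<Rightarrow> 'a set \<Rightarrow> 'b \<Rightarrow> 'b"

locale finite_signature = category \<rho>
  for \<rho> :: "('o, 'm, 'a, 'b) signature" +
  assumes finite_obj: "finite (obj \<rho>)"
    and finite_arr: "finite (arr \<rho>)"
    and functor_obj: "N \<in> obj \<rho> \<Longrightarrow> set_functor (rel_obj \<rho> N) (rel_fun \<rho> N)"
    and functor_arr: "\<nu> \<in> arr \<rho> \<Longrightarrow> natural_transformation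
      (rel_obj \<rho> (src \<rho> \<nu>)) (rel_fun \<rho> (src \<rho> \<nu>)) (rel_obj \<rho> (tgt \<rho> \<nu>)) (rel_fun \<rho> (tgt \<rho> \<nu>))
      (rel_nat \<rho> \<nu>)"
    and functor_ident: "N \<in> obj \<rho> \<Longrightarrow> rel_nat \<rho> (ident \<rho> N) A = (\<lambda>x\<in>rel_obj \<rho> N A. x)"
    and functor_cmp: "\<lbrakk>\<mu> \<in> arr \<rho>; \<nu> \<in> arr \<rho>; src \<rho> \<nu> = tgt \<rho> \<mu>\<rbrakk>
      \<Longrightarrow> rel_nat \<rho> (cmp \<rho> \<nu> \<mu>) A
        = compose (rel_obj \<rho> (src \<rho> \<mu>) A) (rel_nat \<rho> \<nu> A) (rel_nat \<rho> \<mu> A)"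
    and finite_rel: "\<lbrakk>N \<in> obj \<rho>; finite A\<rbrakk> \<Longrightarrow> finite (rel_obj \<rho> N A)"


section \<open>Structures and their isomorphism classes\<close>

type_synonym ('o, 'a, 'b) struct = "'a set \<times> ('o \<Rightarrow> 'b set)"

text \<open>
  The relation assignment is extensional on the objects, so that each structure has exactly one
  representation and counting structures is meaningful.
\<close>

definition Struct :: "('o, 'm, 'a, 'b) signature \<Rightarrow> 'a set \<Rightarrow> ('o, 'a, 'b) struct set" where
  "Struct \<rho> A = {(A, F) | F. F \<in> (\<Pi>\<^sub>E N\<in>obj \<rho>. Pow (rel_obj \<rho> N A)) \<and>
     (\<forall>\<nu>\<in>arr \<rho>. rel_nat \<rho> \<nu> A ` F (src \<rho> \<nu>) \<subseteq> F (tgt \<rho> \<nu>))}"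

definition substructure ::
    "('o, 'm, 'a, 'b) signature \<Rightarrow> ('o, 'a, 'b) struct \<Rightarrow> ('o, 'a, 'b) struct \<Rightarrow> bool" where
  "substructure \<rho> \<BB> \<AA> \<longleftrightarrow> fst \<BB> = fst \<AA> \<and> (\<forall>N\<in>obj \<rho>. snd \<BB> N \<subseteq> snd \<AA> N)"

definition magnitude :: "('o, 'm, 'a, 'b) signature \<Rightarrow> ('o, 'a, 'b) struct \<Rightarrow> nat" where
  "magnitude \<rho> \<AA> = (\<Sum>N\<in>obj \<rho>. card (snd \<AA> N))"

text \<open>The group of permutations of \<open>A\<close> is \<^const>\<open>BijGroup\<close> \<open>A\<close>, whose elements are extensional.\<close>

definition struct_act ::
    "('o, 'm, 'a, 'b) signature \<Rightarrow> ('a \<Rightarrow> 'a) \<Rightarrow> ('o, 'a, 'b) struct \<Rightarrow> ('o, 'a, 'b) struct" where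
  "struct_act \<rho> \<sigma> \<AA> =
     (fst \<AA>, \<lambda>N\<in>obj \<rho>. rel_fun \<rho> N (fst \<AA>) (fst \<AA>) \<sigma> ` snd \<AA> N)"

definition IsoStr :: "('o, 'm, 'a, 'b) signature \<Rightarrow> 'a set \<Rightarrow> ('o, 'a, 'b) struct set set" where
  "IsoStr \<rho> A = orbits (BijGroup A) (Struct \<rho> A) (struct_act \<rho>)"

definition iso_magnitude :: "('o, 'm, 'a, 'b) signature \<Rightarrow> ('o, 'a, 'b) struct set \<Rightarrow> nat" where
  "iso_magnitude \<rho> \<psi> = magnitude \<rho> (SOME \<AA>. \<AA> \<in> \<psi>)"


section \<open>Polynomials\<close>

text \<open>
  Integer polynomials in variables of type \<open>'x\<close>: finitely supported maps from monomials to
  coefficients, where a monomial is a finitely supported map from variables to exponents. The ring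
  structure is the convolution product of \<^theory>\<open>HOL-Library.Poly_Mapping\<close>.
\<close>

type_synonym 'x int_poly = "('x \<Rightarrow>\<^sub>0 nat) \<Rightarrow>\<^sub>0 int"

definition Var :: "'x \<Rightarrow> 'x int_poly" where
  "Var v = Poly_Mapping.single (Poly_Mapping.single v 1) 1"

definition vars :: "'x int_poly \<Rightarrow> 'x set" where
  "vars p = (\<Union>m\<in>Poly_Mapping.keys p. Poly_Mapping.keys m)"

definition polys_over :: "'x set \<Rightarrow> 'x int_poly set" where
  "polys_over V = {p. vars p \<subseteq> V}"

definition subst_poly :: "('x \<Rightarrow> 'r::comm_ring_1) \<Rightarrow> 'x int_poly \<Rightarrow> 'r" where
  "subst_poly f p = (\<Sum>m\<in>Poly_Mapping.keys p. of_int (Poly_Mapping.lookup p m) *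
     (\<Prod>v\<in>Poly_Mapping.keys m. f v ^ Poly_Mapping.lookup m v))"

inductive_set subring_generated :: "'r::ring_1 set \<Rightarrow> 'r set" for S where
  incl: "p \<in> S \<Longrightarrow> p \<in> subring_generated S"
| one: "1 \<in> subring_generated S"
| diff: "\<lbrakk>p \<in> subring_generated S; q \<in> subring_generated S\<rbrakk> \<Longrightarrow> p - q \<in> subring_generated S"
| mult: "\<lbrakk>p \<in> subring_generated S; q \<in> subring_generated S\<rbrakk> \<Longrightarrow> p * q \<in> subring_generated S"

text \<open>The variable \<open>x\<^bsub>N,a\<^esub>\<close> is \<open>Var (N, a)\<close>.\<close>

definition struct_monomial ::
    "('o, 'm, 'a, 'b) signature \<Rightarrow> ('o, 'a, 'b) struct \<Rightarrow> ('o \<times> 'b) int_poly" where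
  "struct_monomial \<rho> \<AA> = (\<Prod>N\<in>obj \<rho>. \<Prod>a\<in>snd \<AA> N. Var (N, a))"

definition Pol :: "('o, 'm, 'a, 'b) signature \<Rightarrow> 'a set \<Rightarrow> ('o \<times> 'b) int_poly set" where
  "Pol \<rho> A = subring_generated (struct_monomial \<rho> ` Struct \<rho> A)"

definition poly_act :: "('o, 'm, 'a, 'b) signature \<Rightarrow> 'a set \<Rightarrow> ('a \<Rightarrow> 'a)
    \<Rightarrow> ('o \<times> 'b) int_poly \<Rightarrow> ('o \<times> 'b) int_poly" where
  "poly_act \<rho> A \<sigma> p = subst_poly (\<lambda>(N, a). Var (N, rel_fun \<rho> N A A \<sigma> a)) p"

definition SymPol :: "('o, 'm, 'a, 'b) signature \<Rightarrow> 'a set \<Rightarrow> ('o \<times> 'b) int_poly set" where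
  "SymPol \<rho> A = {p \<in> Pol \<rho> A. \<forall>\<sigma>\<in>carrier (BijGroup A). poly_act \<rho> A \<sigma> p = p}"


section \<open>The kindred language\<close>

text \<open>
  The body \<open>\<Gamma>'(N, a)\<close> of a quantified formula is a family of formulae indexed by \<open>a\<close>; only its
  values at \<open>a \<in> \<rho>\<^sub>A(N)\<close> matter.
\<close>

datatype ('o, 'b) formula =
  Atom 'o 'b
| Disj "('o, 'b) formula" "('o, 'b) formula"
| Conj "('o, 'b) formula" "('o, 'b) formula"
| Exists 'o "'b \<Rightarrow> ('o, 'b) formula"
| Forall 'o "'b \<Rightarrow> ('o, 'b) formula"

inductive_set lang :: "('o, 'm, 'a, 'b) signature \<Rightarrow> 'a set \<Rightarrow> ('o, 'b) formula set"
  for \<rho> :: "('o, 'm, 'a, 'b) signature" and A :: "'a set" where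
  "\<lbrakk>N \<in> obj \<rho>; a \<in> rel_obj \<rho> N A\<rbrakk> \<Longrightarrow> Atom N a \<in> lang \<rho> A"
| "\<lbrakk>\<Gamma>\<^sub>1 \<in> lang \<rho> A; \<Gamma>\<^sub>2 \<in> lang \<rho> A\<rbrakk> \<Longrightarrow> Disj \<Gamma>\<^sub>1 \<Gamma>\<^sub>2 \<in> lang \<rho> A"
| "\<lbrakk>\<Gamma>\<^sub>1 \<in> lang \<rho> A; \<Gamma>\<^sub>2 \<in> lang \<rho> A\<rbrakk> \<Longrightarrow> Conj \<Gamma>\<^sub>1 \<Gamma>\<^sub>2 \<in> lang \<rho> A"
| "\<lbrakk>N \<in> obj \<rho>; \<And>a. a \<in> rel_obj \<rho> N A \<Longrightarrow> \<Gamma>' a \<in> lang \<rho> A\<rbrakk> \<Longrightarrow> Exists N \<Gamma>' \<in> lang \<rho> A"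
| "\<lbrakk>N \<in> obj \<rho>; \<And>a. a \<in> rel_obj \<rho> N A \<Longrightarrow> \<Gamma>' a \<in> lang \<rho> A\<rbrakk> \<Longrightarrow> Forall N \<Gamma>' \<in> lang \<rho> A"

primrec sat :: "('o, 'm, 'a, 'b) signature \<Rightarrow> ('o, 'a, 'b) struct \<Rightarrow> ('o, 'b) formula \<Rightarrow> bool" where
  "sat \<rho> \<AA> (Atom N a) \<longleftrightarrow> a \<in> snd \<AA> N"
| "sat \<rho> \<AA> (Disj \<Gamma>\<^sub>1 \<Gamma>\<^sub>2) \<longleftrightarrow> sat \<rho> \<AA> \<Gamma>\<^sub>1 \<or> sat \<rho> \<AA> \<Gamma>\<^sub>2"
| "sat \<rho> \<AA> (Conj \<Gamma>\<^sub>1 \<Gamma>\<^sub>2) \<longleftrightarrow> sat \<rho> \<AA> \<Gamma>\<^sub>1 \<and> sat \<rho> \<AA> \<Gamma>\<^sub>2"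
| "sat \<rho> \<AA> (Exists N \<Gamma>') \<longleftrightarrow> (\<exists>a\<in>rel_obj \<rho> N (fst \<AA>). sat \<rho> \<AA> (\<Gamma>' a))"
| "sat \<rho> \<AA> (Forall N \<Gamma>') \<longleftrightarrow> (\<forall>a\<in>rel_obj \<rho> N (fst \<AA>). sat \<rho> \<AA> (\<Gamma>' a))"

primrec realization ::
    "('o, 'm, 'a, 'b) signature \<Rightarrow> 'a set \<Rightarrow> ('o, 'b) formula \<Rightarrow> ('o \<times> 'b) int_poly" where
  "realization \<rho> A (Atom N a) = Var (N, a)"
| "realization \<rho> A (Disj \<Gamma>\<^sub>1 \<Gamma>\<^sub>2) = realization \<rho> A \<Gamma>\<^sub>1 + realization \<rho> A \<Gamma>\<^sub>2"
| "realization \<rho> A (Conj \<Gamma>\<^sub>1 \<Gamma>\<^sub>2) = realization \<rho> A \<Gamma>\<^sub>1 * realization \<rho> A \<Gamma>\<^sub>2"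
| "realization \<rho> A (Exists N \<Gamma>') = (\<Sum>a\<in>rel_obj \<rho> N A. realization \<rho> A (\<Gamma>' a))"
| "realization \<rho> A (Forall N \<Gamma>') = (\<Prod>a\<in>rel_obj \<rho> N A. realization \<rho> A (\<Gamma>' a))"

definition iso_invariant_formula ::
    "('o, 'm, 'a, 'b) signature \<Rightarrow> 'a set \<Rightarrow> ('o, 'b) formula \<Rightarrow> bool" where
  "iso_invariant_formula \<rho> A \<Gamma> \<longleftrightarrow> realization \<rho> A \<Gamma> \<in> SymPol \<rho> A"

definition iso_invariant_property ::
    "('o, 'm, 'a, 'b) signature \<Rightarrow> 'a set \<Rightarrow> (('o, 'a, 'b) struct \<Rightarrow> bool) \<Rightarrow> bool" where
  "iso_invariant_property \<rho> A P \<longleftrightarrow>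
     (\<exists>\<Gamma>\<in>lang \<rho> A. iso_invariant_formula \<rho> A \<Gamma> \<and> (\<forall>\<AA>\<in>Struct \<rho> A. P \<AA> \<longleftrightarrow> sat \<rho> \<AA> \<Gamma>))"

text \<open>
  Disjunctive normal form as a set of disjuncts, each disjunct being the set of atoms of a
  conjunction, so that repeated atoms are removed. An empty set of disjuncts is falsity, an empty
  disjunct is truth.
\<close>

primrec dnf ::
    "('o, 'm, 'a, 'b) signature \<Rightarrow> 'a set \<Rightarrow> ('o, 'b) formula \<Rightarrow> ('o \<times> 'b) set set" where
  "dnf \<rho> A (Atom N a) = {{(N, a)}}"
| "dnf \<rho> A (Disj \<Gamma>\<^sub>1 \<Gamma>\<^sub>2) = dnf \<rho> A \<Gamma>\<^sub>1 \<union> dnf \<rho> A \<Gamma>\<^sub>2"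
| "dnf \<rho> A (Conj \<Gamma>\<^sub>1 \<Gamma>\<^sub>2) = {K \<union> L | K L. K \<in> dnf \<rho> A \<Gamma>\<^sub>1 \<and> L \<in> dnf \<rho> A \<Gamma>\<^sub>2}"
| "dnf \<rho> A (Exists N \<Gamma>') = (\<Union>a\<in>rel_obj \<rho> N A. dnf \<rho> A (\<Gamma>' a))"
| "dnf \<rho> A (Forall N \<Gamma>') =
     {\<Union>a\<in>rel_obj \<rho> N A. K a | K. \<forall>a\<in>rel_obj \<rho> N A. K a \<in> dnf \<rho> A (\<Gamma>' a)}"

definition complexity :: "('o, 'm, 'a, 'b) signature \<Rightarrow> 'a set \<Rightarrow> ('o, 'b) formula \<Rightarrow> nat" where
  "complexity \<rho> A \<Gamma> = (if dnf \<rho> A \<Gamma> = {} then 0 else Max (card ` dnf \<rho> A \<Gamma>))"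

end

theory Submission
  imports Defs
begin

text \<open>
  The polynomial \<open>\<xi>(\<Gamma>)\<close> has nonnegative coefficients, so nothing cancels and the supports of its
  monomials are exactly the disjuncts of the disjunctive normal form of \<open>\<Gamma>\<close>. Monomials of elements of
  \<open>Pol\<close> are products of monomials \<open>y\<^bsub>\<BB>\<^esub>\<close>, hence every disjunct is the set of atoms of a
  structure; symmetry of \<open>\<xi>(\<Gamma>)\<close> makes the set of these structures a union of orbits. Since
  \<open>\<AA>\<close> satisfies \<open>\<Gamma>\<close> iff one of these structures is a substructure of \<open>\<AA>\<close>, the
  sum of the variables of these orbits is a suitable \<open>g\<close>, which is even linear.
\<close>

section \<open>Supports of monomials\<close>

definition nonneg_coeffs :: "'x int_poly \<Rightarrow> bool" where
  "nonneg_coeffs p \<longleftrightarrow> (\<forall>m. 0 \<le> Poly_Mapping.lookup p m)"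

text \<open>Forgetting exponents mirrors the removal of repeated atoms in
  \<open>dnf\<close>.\<close>

definition supports :: "'x int_poly \<Rightarrow> 'x set set" where
  "supports p = Poly_Mapping.keys ` Poly_Mapping.keys p"

lemma finite_supports: "finite (supports p)"
  by (simp add: supports_def)

text \<open>A sum of nonnegative values vanishes only if every summand does, so no key is lost. The
  generic value type covers both uses: integer coefficients of polynomials and natural exponents of
  monomials.\<close>

lemma keys_sum_nonneg:
  fixes f :: "'i \<Rightarrow> 'x \<Rightarrow>\<^sub>0 'c::ordered_comm_monoid_add"
  assumes "finite I" and "\<And>i m. i \<in> I \<Longrightarrow> 0 \<le> Poly_Mapping.lookup (f i) m"
  shows "Poly_Mapping.keys (\<Sum>i\<in>I. f i) = (\<Union>i\<in>I. Poly_Mapping.keys (f i))"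
  using assms by (auto simp: in_keys_iff lookup_sum sum_nonneg_eq_0_iff)

lemma keys_add_nat:
  fixes m n :: "'x \<Rightarrow>\<^sub>0 nat"
  shows "Poly_Mapping.keys (m + n) = Poly_Mapping.keys m \<union> Poly_Mapping.keys n"
  by (auto simp: in_keys_iff lookup_add)

section \<open>Nonnegativity and supports under the ring operations\<close>

lemma nonneg_coeffs_Var: "nonneg_coeffs (Var v)"
  by (simp add: nonneg_coeffs_def Var_def lookup_single when_def)

lemma nonneg_coeffs_add: "\<lbrakk>nonneg_coeffs p; nonneg_coeffs q\<rbrakk> \<Longrightarrow> nonneg_coeffs (p + q)"
  by (simp add: nonneg_coeffs_def lookup_add)

lemma nonneg_coeffs_sum: "(\<And>i. i \<in> I \<Longrightarrow> nonneg_coeffs (f i)) \<Longrightarrow> nonneg_coeffs (\<Sum>i\<in>I. f i)"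
  by (simp add: nonneg_coeffs_def lookup_sum sum_nonneg)

lemma poly_eq_sum_single:
  fixes p :: "'x int_poly"
  shows "p = (\<Sum>m\<in>Poly_Mapping.keys p. Poly_Mapping.single m (Poly_Mapping.lookup p m))"
proof (rule poly_mapping_eqI)
  fix k
  have "(\<Sum>m\<in>Poly_Mapping.keys p. Poly_Mapping.lookup p m when m = k) = Poly_Mapping.lookup p k"
    by (simp add: when_def in_keys_iff)
  then show "Poly_Mapping.lookup p k = Poly_Mapping.lookup
      (\<Sum>m\<in>Poly_Mapping.keys p. Poly_Mapping.single m (Poly_Mapping.lookup p m)) k"
    by (simp add: lookup_sum lookup_single)
qed

text \<open>Turns the convolution product into a finite sum of single terms, to which the lemmas on
  sums apply.\<close>

lemma poly_mult_eq_sum_single: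
  fixes p q :: "'x int_poly"
  shows "p * q = (\<Sum>(m, n)\<in>Poly_Mapping.keys p \<times> Poly_Mapping.keys q.
    Poly_Mapping.single (m + n) (Poly_Mapping.lookup p m * Poly_Mapping.lookup q n))"
proof -
  have "p * q = (\<Sum>m\<in>Poly_Mapping.keys p. Poly_Mapping.single m (Poly_Mapping.lookup p m)) *
      (\<Sum>n\<in>Poly_Mapping.keys q. Poly_Mapping.single n (Poly_Mapping.lookup q n))"
    by (simp flip: poly_eq_sum_single)
  then show ?thesis
    by (simp add: sum_product sum.cartesian_product mult_single)
qed

lemma nonneg_coeffs_mult:
  assumes "nonneg_coeffs p" "nonneg_coeffs q"
  shows "nonneg_coeffs (p * q)"
  unfolding poly_mult_eq_sum_single
  using assms by (intro nonneg_coeffs_sum) (auto simp: nonneg_coeffs_def lookup_single when_def)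

text \<open>Several pairs \<open>(m, n)\<close> may share the sum \<open>m + n\<close>, but each
  contributes a product of two positive integers, so they cannot cancel.\<close>

lemma keys_mult_nonneg:
  assumes "nonneg_coeffs p" "nonneg_coeffs q"
  shows "Poly_Mapping.keys (p * q) =
    {m + n | m n. m \<in> Poly_Mapping.keys p \<and> n \<in> Poly_Mapping.keys q}"
  unfolding poly_mult_eq_sum_single using assms
  by (subst keys_sum_nonneg)
    (auto simp: nonneg_coeffs_def lookup_single when_def split: if_splits; blast)+

lemma supports_Var: "supports (Var v) = {{v}}"
  by (simp add: supports_def Var_def)

lemma supports_add:
  assumes "nonneg_coeffs p" "nonneg_coeffs q"
  shows "supports (p + q) = supports p \<union> supports q"
proof -
  have "Poly_Mapping.keys (p + q) = Poly_Mapping.keys p \<union> Poly_Mapping.keys q"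
    using assms by (auto simp: in_keys_iff lookup_add nonneg_coeffs_def add_nonneg_eq_0_iff)
  then show ?thesis
    by (simp add: supports_def image_Un)
qed

lemma supports_mult:
  assumes "nonneg_coeffs p" "nonneg_coeffs q"
  shows "supports (p * q) = {K \<union> L | K L. K \<in> supports p \<and> L \<in> supports q}"
  unfolding supports_def keys_mult_nonneg[OF assms]
  by (auto simp: image_iff Bex_def) (metis keys_add_nat)+

lemma supports_sum:
  assumes "finite I" "\<And>i. i \<in> I \<Longrightarrow> nonneg_coeffs (f i)"
  shows "supports (\<Sum>i\<in>I. f i) = (\<Union>i\<in>I. supports (f i))"
  using assms by (simp add: supports_def keys_sum_nonneg nonneg_coeffs_def image_UN)

lemma supports_one: "supports (1 :: 'x int_poly) = {{}}"
  by (simp add: supports_def)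

lemma nonneg_coeffs_prod:
  "(\<And>i. i \<in> I \<Longrightarrow> nonneg_coeffs (f i)) \<Longrightarrow> nonneg_coeffs (\<Prod>i\<in>I. f i)"
proof (induction I rule: infinite_finite_induct)
  case (insert i I)
  then show ?case by (simp add: nonneg_coeffs_mult)
\<comment> \<open>Infinite and empty index sets both give the product 1.\<close>
qed (simp_all add: nonneg_coeffs_def lookup_one when_def)

text \<open>Multiplying out picks one monomial from each factor; \<open>K\<close> records the
  supports picked. This is the shape of the \<open>Forall\<close> clause of
  \<open>dnf\<close>.\<close>

lemma supports_prod:
  assumes "finite I" "\<And>i. i \<in> I \<Longrightarrow> nonneg_coeffs (f i)"
  shows "supports (\<Prod>i\<in>I. f i) = {\<Union>i\<in>I. K i | K. \<forall>i\<in>I. K i \<in> supports (f i)}"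
  using assms
proof (induction I rule: finite_induct)
  case empty
  then show ?case by (simp add: supports_one)
next
  case (insert j I)
  have "supports (\<Prod>i\<in>insert j I. f i) =
      {K \<union> L | K L. K \<in> supports (f j) \<and> L \<in> supports (\<Prod>i\<in>I. f i)}"
    using insert by (simp add: supports_mult nonneg_coeffs_prod)
  also have "\<dots> = {K \<union> (\<Union>i\<in>I. L i) | K L. K \<in> supports (f j) \<and> (\<forall>i\<in>I. L i \<in> supports (f i))}"
    using insert by auto
  also have "\<dots> = {\<Union>i\<in>insert j I. K i | K. \<forall>i\<in>insert j I. K i \<in> supports (f i)}"
  proof (intro equalityI subsetI)
    fix D
    assume "D \<in> {K \<union> (\<Union>i\<in>I. L i) | K L. K \<in> supports (f j) \<and> (\<forall>i\<in>I. L i \<in> supports (f i))}"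
    then obtain K L where D: "D = K \<union> (\<Union>i\<in>I. L i)" "K \<in> supports (f j)"
      "\<forall>i\<in>I. L i \<in> supports (f i)" by blast
    \<comment> \<open>Since \<open>j\<close> lies outside \<open>I\<close>, the update extends the
      choice \<open>L\<close> to \<open>j\<close> without changing it on \<open>I\<close>.\<close>
    have "D = (\<Union>i\<in>insert j I. (L(j := K)) i)" "\<forall>i\<in>insert j I. (L(j := K)) i \<in> supports (f i)"
      using D \<open>j \<notin> I\<close> by auto
    then show "D \<in> {\<Union>i\<in>insert j I. K i | K. \<forall>i\<in>insert j I. K i \<in> supports (f i)}"
      by blast
  next
    fix D
    assume "D \<in> {\<Union>i\<in>insert j I. K i | K. \<forall>i\<in>insert j I. K i \<in> supports (f i)}"
    then obtain K where "D = K j \<union> (\<Union>i\<in>I. K i)" "\<forall>i\<in>insert j I. K i \<in> supports (f i)"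
      by auto
    then show "D \<in> {K \<union> (\<Union>i\<in>I. L i) | K L. K \<in> supports (f j) \<and> (\<forall>i\<in>I. L i \<in> supports (f i))}"
      by blast
  qed
  finally show ?case .
qed

section \<open>Renaming variables and evaluating sums of variables\<close>

lemma Var_power: "Var v ^ k = Poly_Mapping.single (Poly_Mapping.single v k) 1"
  by (induction k) (simp_all add: Var_def mult_single flip: single_add)

lemma prod_Var_power:
  "finite V \<Longrightarrow> (\<Prod>v\<in>V. Var (h v) ^ k v) =
    Poly_Mapping.single (\<Sum>v\<in>V. Poly_Mapping.single (h v) (k v)) 1"
  by (induction V rule: finite_induct) (simp_all add: Var_power mult_single)

text \<open>Where \<open>h\<close> identifies variables, their positive exponents add up to a
  positive exponent.\<close>

lemma keys_sum_single:
  assumes "finite V" "\<And>v. v \<in> V \<Longrightarrow> k v \<noteq> 0"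
  shows "Poly_Mapping.keys (\<Sum>v\<in>V. Poly_Mapping.single (h v) (k v :: nat)) = h ` V"
  using assms by (subst keys_sum_nonneg) auto

text \<open>Renaming may merge monomials, but their nonnegative coefficients add without cancelling,
  so every image survives. It serves to express the symmetry of a polynomial through its
  supports.\<close>

lemma supports_rename:
  fixes p :: "'a int_poly" and h :: "'a \<Rightarrow> 'b"
  assumes "nonneg_coeffs p"
  shows "supports (subst_poly (\<lambda>v. Var (h v)) p) = image h ` supports p"
proof -
  define r where "r m = (\<Sum>v\<in>Poly_Mapping.keys m.
    Poly_Mapping.single (h v) (Poly_Mapping.lookup m v))" for m :: "'a \<Rightarrow>\<^sub>0 nat"
  have r: "Poly_Mapping.keys (r m) = h ` Poly_Mapping.keys m" for m
    unfolding r_def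
    using keys_sum_single[of "Poly_Mapping.keys m" "Poly_Mapping.lookup m" h]
    by (simp add: in_keys_iff)
  \<comment> \<open>Scalars are written as constant terms so that \<open>mult_single\<close> can
    merge them with the monomials.\<close>
  have "(of_int c :: 'b int_poly) = Poly_Mapping.single 0 c" for c
    by (metis single_of_int of_int_eq_id id_apply)
  then have "subst_poly (\<lambda>v. Var (h v)) p =
      (\<Sum>m\<in>Poly_Mapping.keys p. Poly_Mapping.single (r m) (Poly_Mapping.lookup p m))"
    by (simp add: subst_poly_def prod_Var_power mult_single r_def)
  also have "Poly_Mapping.keys \<dots> = r ` Poly_Mapping.keys p"
    using assms by (subst keys_sum_nonneg)
      (auto simp: nonneg_coeffs_def lookup_single when_def in_keys_iff)
  finally show ?thesis
    by (simp add: supports_def image_image r)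
qed

lemma vars_sum_Var: "finite S \<Longrightarrow> vars (\<Sum>v\<in>S. Var v) = S"
  by (simp add: vars_def keys_sum_nonneg Var_def lookup_single when_def)

text \<open>Distinct variables are distinct monomials, so each has coefficient 1 in the sum.\<close>

lemma subst_poly_sum_Var:
  assumes "finite S"
  shows "subst_poly f (\<Sum>v\<in>S. Var v) = (\<Sum>v\<in>S. f v)"
proof -
  have inj: "inj_on (\<lambda>v. Poly_Mapping.single v (1::nat)) S"
    by (rule inj_onI) (metis keys_single one_neq_zero singleton_inject)
  have "Poly_Mapping.lookup (\<Sum>v\<in>S. Var v) (Poly_Mapping.single w 1) = 1" if "w \<in> S" for w
  proof -
    have "Poly_Mapping.lookup (\<Sum>v\<in>S. Var v) (Poly_Mapping.single w 1) =
        (\<Sum>v\<in>S. if v = w then 1 else 0)"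
      unfolding lookup_sum Var_def lookup_single when_def
      using inj that by (intro sum.cong) (auto dest: inj_onD)
    then show ?thesis using assms that by simp
  qed
  moreover have "Poly_Mapping.keys (\<Sum>v\<in>S. Var v) = (\<lambda>v. Poly_Mapping.single v 1) ` S"
    using assms by (subst keys_sum_nonneg) (auto simp: Var_def lookup_single when_def)
  ultimately show ?thesis
    using inj by (simp add: subst_poly_def sum.reindex)
qed


section \<open>Formulae and their disjunctive normal forms\<close>

context finite_signature
begin

text \<open>The clauses of \<open>realization\<close> and \<open>dnf\<close> match: sums give unions
  of support sets, products give unions of chosen supports. Nonnegativity is carried through the
  induction because the support rules require it; finiteness of \<open>A\<close> makes the
  quantifier ranges finite.\<close>

lemma realization_nonneg_supports:
  assumes "finite A" "\<Gamma> \<in> lang \<rho> A"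
  shows "nonneg_coeffs (realization \<rho> A \<Gamma>) \<and> supports (realization \<rho> A \<Gamma>) = dnf \<rho> A \<Gamma>"
  using assms(2)
proof induction
  case (1 N a)
  show ?case by (simp add: nonneg_coeffs_Var supports_Var)
next
  case (2 \<Gamma>\<^sub>1 \<Gamma>\<^sub>2)
  then show ?case by (simp add: nonneg_coeffs_add supports_add)
next
  case (3 \<Gamma>\<^sub>1 \<Gamma>\<^sub>2)
  then show ?case by (simp add: nonneg_coeffs_mult supports_mult)
next
  case (4 N \<Gamma>')
  then show ?case
    using finite_rel[OF _ \<open>finite A\<close>] by (simp add: nonneg_coeffs_sum supports_sum)
next
  case (5 N \<Gamma>')
  then show ?case
    using finite_rel[OF _ \<open>finite A\<close>] by (simp add: nonneg_coeffs_prod supports_prod)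
qed

lemma dnf_subset:
  assumes "\<Gamma> \<in> lang \<rho> A" "D \<in> dnf \<rho> A \<Gamma>"
  shows "D \<subseteq> Sigma (obj \<rho>) (\<lambda>N. rel_obj \<rho> N A)"
  using assms
proof (induction arbitrary: D)
  case (5 N \<Gamma>')
  then obtain K where "D = (\<Union>a\<in>rel_obj \<rho> N A. K a)" "\<forall>a\<in>rel_obj \<rho> N A. K a \<in> dnf \<rho> A (\<Gamma>' a)"
    by auto
  then show ?case using 5 by blast
qed fastforce+

lemma sat_iff_dnf:
  assumes "\<Gamma> \<in> lang \<rho> A" "fst \<AA> = A"
  shows "sat \<rho> \<AA> \<Gamma> \<longleftrightarrow> (\<exists>D\<in>dnf \<rho> A \<Gamma>. \<forall>(N, a)\<in>D. a \<in> snd \<AA> N)"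
  using assms(1)
proof induction
  case (3 \<Gamma>\<^sub>1 \<Gamma>\<^sub>2)
  define Q where "Q D \<longleftrightarrow> (\<forall>(N, a)\<in>D. a \<in> snd \<AA> N)" for D
  have "Q (K \<union> L) \<longleftrightarrow> Q K \<and> Q L" for K L
    by (auto simp: Q_def)
  then have "(\<exists>D\<in>dnf \<rho> A (Conj \<Gamma>\<^sub>1 \<Gamma>\<^sub>2). Q D) \<longleftrightarrow>
      (\<exists>K\<in>dnf \<rho> A \<Gamma>\<^sub>1. Q K) \<and> (\<exists>L\<in>dnf \<rho> A \<Gamma>\<^sub>2. Q L)"
    by auto
  with 3 show ?case by (simp only: Q_def sat.simps)
next
  case (5 N \<Gamma>')
  define Q where "Q D \<longleftrightarrow> (\<forall>(N, a)\<in>D. a \<in> snd \<AA> N)" for D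
  have Q_UN: "Q (\<Union>a\<in>I. K a) \<longleftrightarrow> (\<forall>a\<in>I. Q (K a))" for I and K :: "'b \<Rightarrow> ('o \<times> 'b) set"
    by (auto simp: Q_def)
  \<comment> \<open>By choice, a satisfied disjunct for each \<open>a\<close> becomes one function
    \<open>K\<close>; by \<open>Q_UN\<close> the union of its values is a satisfied disjunct of the
    \<open>Forall\<close> formula.\<close>
  have "(\<forall>a\<in>rel_obj \<rho> N A. \<exists>D\<in>dnf \<rho> A (\<Gamma>' a). Q D) \<longleftrightarrow>
      (\<exists>K. \<forall>a\<in>rel_obj \<rho> N A. K a \<in> dnf \<rho> A (\<Gamma>' a) \<and> Q (K a))"
    by (simp only: Bex_def bchoice_iff)
  also have "\<dots> \<longleftrightarrow> (\<exists>D\<in>dnf \<rho> A (Forall N \<Gamma>'). Q D)"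
    by (simp only: ball_conj_distrib dnf.simps Bex_def mem_Collect_eq flip: Q_UN) metis
  finally show ?case
    using 5(3) assms(2) by (simp add: Q_def del: dnf.simps)
qed (use assms(2) in auto)


section \<open>Structures as sets of atoms\<close>

text \<open>The morphism condition of \<open>Struct\<close>, stated for arbitrary sets of pairs so
  that it can be tested on supports of monomials.\<close>

definition closed_atoms :: "'a set \<Rightarrow> ('o \<times> 'b) set \<Rightarrow> bool" where
  "closed_atoms A D \<longleftrightarrow>
     (\<forall>\<nu>\<in>arr \<rho>. \<forall>a. (src \<rho> \<nu>, a) \<in> D \<longrightarrow> (tgt \<rho> \<nu>, rel_nat \<rho> \<nu> A a) \<in> D)"

definition atoms :: "('o, 'a, 'b) struct \<Rightarrow> ('o \<times> 'b) set" where
  "atoms \<AA> = Sigma (obj \<rho>) (snd \<AA>)"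

text \<open>Restricting the function to \<open>obj \<rho>\<close> gives the extensional
  representation that \<open>Struct\<close> demands.\<close>

definition struct_of_atoms :: "'a set \<Rightarrow> ('o \<times> 'b) set \<Rightarrow> ('o, 'a, 'b) struct" where
  "struct_of_atoms A D = (A, \<lambda>N\<in>obj \<rho>. {a. (N, a) \<in> D})"

lemma fst_struct_of_atoms [simp]: "fst (struct_of_atoms A D) = A"
  by (simp add: struct_of_atoms_def)

lemma struct_of_atoms_in_Struct:
  assumes "D \<subseteq> Sigma (obj \<rho>) (\<lambda>N. rel_obj \<rho> N A)" "closed_atoms A D"
  shows "struct_of_atoms A D \<in> Struct \<rho> A"
  using assms src_obj tgt_obj by (auto simp: struct_of_atoms_def Struct_def closed_atoms_def)

lemma atoms_struct_of_atoms:
  "D \<subseteq> Sigma (obj \<rho>) (\<lambda>N. rel_obj \<rho> N A) \<Longrightarrow> atoms (struct_of_atoms A D) = D"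
  by (auto simp: atoms_def struct_of_atoms_def)

lemma substructure_iff_atoms:
  "substructure \<rho> \<BB> \<AA> \<longleftrightarrow> fst \<BB> = fst \<AA> \<and> atoms \<BB> \<subseteq> atoms \<AA>"
  by (auto simp: substructure_def atoms_def)

lemma fst_Struct: "\<AA> \<in> Struct \<rho> A \<Longrightarrow> fst \<AA> = A"
  by (auto simp: Struct_def)

lemma finite_atoms_N:
  assumes "finite A" "\<AA> \<in> Struct \<rho> A" "N \<in> obj \<rho>"
  shows "finite (snd \<AA> N)"
proof -
  have "snd \<AA> N \<subseteq> rel_obj \<rho> N A"
    using assms by (fastforce simp: Struct_def PiE_iff)
  then show ?thesis using finite_rel[OF assms(3,1)] finite_subset by blast
qed

lemma finite_atoms:
  assumes "finite A" "\<AA> \<in> Struct \<rho> A"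
  shows "finite (atoms \<AA>)"
  using assms by (auto simp: atoms_def intro: finite_obj finite_atoms_N)

lemma magnitude_eq_card_atoms:
  assumes "finite (atoms \<AA>)"
  shows "magnitude \<rho> \<AA> = card (atoms \<AA>)"
proof -
  have "finite (snd \<AA> N)" if "N \<in> obj \<rho>" for N
  proof -
    have "snd \<AA> N \<subseteq> snd ` atoms \<AA>" using that by (force simp: atoms_def)
    then show ?thesis using assms finite_subset by blast
  qed
  then show ?thesis by (simp add: magnitude_def atoms_def finite_obj)
qed

lemma sat_iff_dnf_atoms:
  assumes "\<Gamma> \<in> lang \<rho> A" "fst \<AA> = A"
  shows "sat \<rho> \<AA> \<Gamma> \<longleftrightarrow> (\<exists>D\<in>dnf \<rho> A \<Gamma>. D \<subseteq> atoms \<AA>)"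
proof -
  have "(\<forall>(N, a)\<in>D. a \<in> snd \<AA> N) \<longleftrightarrow> D \<subseteq> atoms \<AA>" if "D \<in> dnf \<rho> A \<Gamma>" for D
    using dnf_subset[OF assms(1) that] by (auto simp: atoms_def)
  then show ?thesis using sat_iff_dnf[OF assms] by auto
qed

text \<open>Flattening the double product over the pairs in \<open>atoms \<AA>\<close> leaves a
  single squarefree monomial.\<close>

lemma supports_struct_monomial:
  assumes "finite A" "\<AA> \<in> Struct \<rho> A"
  shows "supports (struct_monomial \<rho> \<AA>) = {atoms \<AA>}"
proof -
  note fin = finite_atoms[OF assms]
  have "struct_monomial \<rho> \<AA> = (\<Prod>v\<in>atoms \<AA>. Var v)"
    unfolding struct_monomial_def atoms_def
    by (subst prod.Sigma) (use finite_obj finite_atoms_N[OF assms] in \<open>simp_all add: case_prod_unfold\<close>)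
  also have "\<dots> = Poly_Mapping.single (\<Sum>v\<in>atoms \<AA>. Poly_Mapping.single v 1) 1"
    using prod_Var_power[OF fin, of "\<lambda>v. v" "\<lambda>_. 1"] by simp
  also have "supports \<dots> = {atoms \<AA>}"
    using keys_sum_single[OF fin, of "\<lambda>_. 1" "\<lambda>v. v"] by (simp add: supports_def)
  finally show ?thesis .
qed

lemma closed_atoms_struct:
  assumes "\<AA> \<in> Struct \<rho> A"
  shows "closed_atoms A (atoms \<AA>)"
  unfolding closed_atoms_def
proof (intro ballI allI impI)
  fix \<nu> a
  assume \<nu>: "\<nu> \<in> arr \<rho>" and a: "(src \<rho> \<nu>, a) \<in> atoms \<AA>"
  obtain F where "\<AA> = (A, F)" and F: "\<forall>\<nu>\<in>arr \<rho>. rel_nat \<rho> \<nu> A ` F (src \<rho> \<nu>) \<subseteq> F (tgt \<rho> \<nu>)"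
    using assms by (auto simp: Struct_def)
  with bspec[OF F \<nu>] show "(tgt \<rho> \<nu>, rel_nat \<rho> \<nu> A a) \<in> atoms \<AA>"
    using a tgt_obj[OF \<nu>] by (auto simp: atoms_def)
qed

text \<open>Generators have closed supports, 1 has empty support, and closedness survives unions.
  Elements of the subring may have negative coefficients, so only inclusions are used: keys of a
  difference come from one of the two operands, keys of a product are sums of keys.\<close>

lemma closed_atoms_Pol:
  assumes "finite A" "p \<in> Pol \<rho> A" "D \<in> supports p"
  shows "closed_atoms A D"
  using assms(2,3) unfolding Pol_def
proof (induction arbitrary: D)
  case (incl p)
  then show ?case using assms(1) supports_struct_monomial closed_atoms_struct by auto
next
  case one
  then show ?case by (simp add: supports_one closed_atoms_def)
next
  case (diff p q)
  have "supports (p - q) \<subseteq> supports p \<union> supports q"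
    unfolding supports_def using keys_diff[of p q] by blast
  then show ?case using diff by blast
next
  case (mult p q)
  obtain m n where "D = Poly_Mapping.keys m \<union> Poly_Mapping.keys n"
    "m \<in> Poly_Mapping.keys p" "n \<in> Poly_Mapping.keys q"
    using mult.prems keys_mult[of p q] by (auto simp: supports_def keys_add_nat)
  then show ?case
    using mult.IH[of "Poly_Mapping.keys m"] mult.IH[of "Poly_Mapping.keys n"]
    by (auto simp: supports_def closed_atoms_def)
qed

text \<open>The map on pairs is the one by which \<open>poly_act\<close> renames variables; this
  links the actions on structures and on polynomials.\<close>

lemma atoms_struct_act:
  assumes "fst \<BB> = A"
  shows "atoms (struct_act \<rho> \<sigma> \<BB>) = (\<lambda>(N, a). (N, rel_fun \<rho> N A A \<sigma> a)) ` atoms \<BB>"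
proof -
  have "atoms (struct_act \<rho> \<sigma> \<BB>) = Sigma (obj \<rho>) (\<lambda>N. rel_fun \<rho> N A A \<sigma> ` snd \<BB> N)"
    using assms by (simp add: atoms_def struct_act_def cong: Sigma_cong)
  then show ?thesis
    by (auto simp: atoms_def image_iff)
qed

text \<open>Functors preserve identities. This places a structure in its own orbit, directly from
  the definition of \<open>orbit\<close>.\<close>

lemma struct_act_ident:
  assumes "\<BB> \<in> Struct \<rho> A"
  shows "struct_act \<rho> (\<lambda>x\<in>A. x) \<BB> = \<BB>"
proof -
  obtain F where F: "\<BB> = (A, F)" "F \<in> (\<Pi>\<^sub>E N\<in>obj \<rho>. Pow (rel_obj \<rho> N A))"
    using assms by (auto simp: Struct_def)
  have "rel_fun \<rho> N A A (\<lambda>x\<in>A. x) ` F N = F N" if "N \<in> obj \<rho>" for N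
  proof -
    have "F N \<subseteq> rel_obj \<rho> N A" using F(2) that by (auto simp: PiE_iff)
    then show ?thesis
      using set_functor.map_ident[OF functor_obj[OF that], of A] by (auto simp: image_iff subset_iff)
  qed
  then show ?thesis
    using F by (auto simp: struct_act_def PiE_iff extensional_def fun_eq_iff)
qed

end

text \<open>A finite set has finitely many extensional self-maps, hence finitely many
  permutations.\<close>

lemma finite_orbit_BijGroup:
  assumes "finite A"
  shows "finite (orbit (BijGroup A) \<phi> x)"
proof -
  have "carrier (BijGroup A) \<subseteq> A \<rightarrow>\<^sub>E A"
    by (auto simp: BijGroup_def Bij_def PiE_def bij_betw_def)
  then have "finite (carrier (BijGroup A))"
    using assms finite_PiE finite_subset by metis
  moreover have "orbit (BijGroup A) \<phi> x = (\<lambda>g. \<phi> g x) ` carrier (BijGroup A)"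
    by (auto simp: orbit_def)
  ultimately show ?thesis by simp
qed

section \<open>The linear polynomial of the orbits of disjuncts\<close>

theorem corollary1:
  fixes \<rho> :: "('o, 'm, 'a, 'b) signature"
    and A :: "'a set"
    and P :: "('o, 'a, 'b) struct \<Rightarrow> bool"
    and \<Gamma> :: "('o, 'b) formula"
  assumes "finite_signature \<rho>"
    and "finite A"
    and "iso_invariant_property \<rho> A P"
    and "\<Gamma> \<in> lang \<rho> A"
    and "iso_invariant_formula \<rho> A \<Gamma>"
    and "\<forall>\<AA>\<in>Struct \<rho> A. P \<AA> \<longleftrightarrow> sat \<rho> \<AA> \<Gamma>"
  shows "\<exists>g \<in> polys_over (IsoStr \<rho> A).
    (\<forall>\<AA>\<in>Struct \<rho> A. P \<AA> \<longleftrightarrow>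
       subst_poly (\<lambda>\<psi>. int (card {\<BB> \<in> \<psi>. substructure \<rho> \<BB> \<AA>})) g > 0) \<and>
    (\<forall>\<psi>\<in>vars g. iso_magnitude \<rho> \<psi> \<le> complexity \<rho> A \<Gamma>)"
proof -
  interpret finite_signature \<rho> by fact
  let ?p = "realization \<rho> A \<Gamma>"
  let ?orb = "orbit (BijGroup A) (struct_act \<rho>)"
  note p = realization_nonneg_supports[OF \<open>finite A\<close> \<open>\<Gamma> \<in> lang \<rho> A\<close>]
  have sym: "?p \<in> Pol \<rho> A" "\<And>\<sigma>. \<sigma> \<in> carrier (BijGroup A) \<Longrightarrow> poly_act \<rho> A \<sigma> ?p = ?p"
    using assms(5) by (auto simp: iso_invariant_formula_def SymPol_def)
  have fin: "finite (dnf \<rho> A \<Gamma>)"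
    using p finite_supports by metis
  have fin_disjunct: "finite D" if "D \<in> dnf \<rho> A \<Gamma>" for D
    using that p unfolding supports_def by (metis finite_keys imageE)
  have sub: "D \<subseteq> Sigma (obj \<rho>) (\<lambda>N. rel_obj \<rho> N A)" if "D \<in> dnf \<rho> A \<Gamma>" for D
    using dnf_subset[OF assms(4) that] .
  \<comment> \<open>A disjunct is a support of an element of \<open>Pol \<rho> A\<close>, hence
    closed under the morphisms.\<close>
  have struct: "struct_of_atoms A D \<in> Struct \<rho> A" if "D \<in> dnf \<rho> A \<Gamma>" for D
    using struct_of_atoms_in_Struct[OF sub[OF that]] closed_atoms_Pol[OF assms(2) sym(1)] that p
    by auto
  have image_dnf: "(\<lambda>(N, a). (N, rel_fun \<rho> N A A \<sigma> a)) ` D \<in> dnf \<rho> A \<Gamma>"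
    if "\<sigma> \<in> carrier (BijGroup A)" "D \<in> dnf \<rho> A \<Gamma>" for \<sigma> D
  proof -
    define h where "h = (\<lambda>(N, a). (N, rel_fun \<rho> N A A \<sigma> a))"
    have "subst_poly (\<lambda>v. Var (h v)) ?p = ?p"
      using sym(2)[OF that(1)] by (simp add: poly_act_def h_def case_prod_unfold)
    then have "dnf \<rho> A \<Gamma> = image h ` dnf \<rho> A \<Gamma>"
      using supports_rename[OF conjunct1[OF p], of h] conjunct2[OF p] by simp
    then have "h ` D \<in> dnf \<rho> A \<Gamma>" using that(2) by blast
    then show ?thesis by (simp add: h_def)
  qed
  \<comment> \<open>Permuting a disjunct gives a disjunct again, so this holds throughout the orbit
    and not just for its representative.\<close>
  have orbit_dnf: "fst \<BB> = A \<and> atoms \<BB> \<in> dnf \<rho> A \<Gamma>"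
    if D: "D \<in> dnf \<rho> A \<Gamma>" and \<BB>: "\<BB> \<in> ?orb (struct_of_atoms A D)" for \<BB> D
  proof -
    obtain \<sigma> where \<sigma>: "\<sigma> \<in> carrier (BijGroup A)" "\<BB> = struct_act \<rho> \<sigma> (struct_of_atoms A D)"
      using \<BB> by (auto simp: orbit_def)
    then show ?thesis
      using image_dnf[OF \<sigma>(1) D] atoms_struct_of_atoms[OF sub[OF D]]
      by (simp add: atoms_struct_act) (simp add: struct_act_def)
  qed
  have orbit_self: "struct_of_atoms A D \<in> ?orb (struct_of_atoms A D)" if "D \<in> dnf \<rho> A \<Gamma>" for D
  proof -
    have "(\<lambda>x\<in>A. x) \<in> carrier (BijGroup A)" by (simp add: BijGroup_def id_Bij)
    then show ?thesis
      using struct_act_ident[OF struct[OF that]] unfolding orbit_def by force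
  qed

  \<comment> \<open>Isomorphic disjuncts collapse to one class, so each class contributes its
    variable once to the witness.\<close>
  define S where "S = (\<lambda>D. ?orb (struct_of_atoms A D)) ` dnf \<rho> A \<Gamma>"
  have "finite S" using fin by (simp add: S_def)
  have "S \<subseteq> IsoStr \<rho> A"
    using struct unfolding S_def IsoStr_def orbits_def by blast
  moreover have "P \<AA> \<longleftrightarrow>
      subst_poly (\<lambda>\<psi>. int (card {\<BB> \<in> \<psi>. substructure \<rho> \<BB> \<AA>})) (\<Sum>\<psi>\<in>S. Var \<psi>) > 0"
    if "\<AA> \<in> Struct \<rho> A" for \<AA>
  proof -
    \<comment> \<open>The equivalence is proved in negated form: a sum of counts fails to be
      positive iff every count is 0.\<close>
    have "\<not> 0 < (\<Sum>\<psi>\<in>S. int (card {\<BB> \<in> \<psi>. substructure \<rho> \<BB> \<AA>})) \<longleftrightarrow>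
        (\<forall>\<psi>\<in>S. card {\<BB> \<in> \<psi>. substructure \<rho> \<BB> \<AA>} = 0)"
      using \<open>finite S\<close> sum_nonneg_eq_0_iff[of S "\<lambda>\<psi>. card {\<BB> \<in> \<psi>. substructure \<rho> \<BB> \<AA>}"]
      by (simp flip: of_nat_sum)
    also have "\<dots> \<longleftrightarrow> (\<forall>\<psi>\<in>S. {\<BB> \<in> \<psi>. substructure \<rho> \<BB> \<AA>} = {})"
    proof (intro ball_cong refl)
      fix \<psi> assume "\<psi> \<in> S"
      \<comment> \<open>Finiteness matters because \<open>card\<close> is 0 on infinite sets as
        well.\<close>
      then have "finite {\<BB> \<in> \<psi>. substructure \<rho> \<BB> \<AA>}"
        using finite_orbit_BijGroup[OF \<open>finite A\<close>] unfolding S_def by force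
      then show "card {\<BB> \<in> \<psi>. substructure \<rho> \<BB> \<AA>} = 0 \<longleftrightarrow>
          {\<BB> \<in> \<psi>. substructure \<rho> \<BB> \<AA>} = {}"
        by (simp only: card_0_eq)
    qed
    also have "\<dots> \<longleftrightarrow> (\<forall>D\<in>dnf \<rho> A \<Gamma>. \<not> D \<subseteq> atoms \<AA>)"
    proof (intro iffI ballI notI)
      fix D
      assume none: "\<forall>\<psi>\<in>S. {\<BB> \<in> \<psi>. substructure \<rho> \<BB> \<AA>} = {}"
        and D: "D \<in> dnf \<rho> A \<Gamma>" "D \<subseteq> atoms \<AA>"
      have "substructure \<rho> (struct_of_atoms A D) \<AA>"
        using D \<open>\<AA> \<in> Struct \<rho> A\<close>
        by (simp add: substructure_iff_atoms fst_Struct atoms_struct_of_atoms[OF sub])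
      moreover have "?orb (struct_of_atoms A D) \<in> S"
        using D(1) by (simp add: S_def)
      ultimately show False
        using orbit_self[OF D(1)] none by blast
    next
      fix \<psi>
      assume none: "\<forall>D\<in>dnf \<rho> A \<Gamma>. \<not> D \<subseteq> atoms \<AA>" and "\<psi> \<in> S"
      then obtain D where D: "D \<in> dnf \<rho> A \<Gamma>" "\<psi> = ?orb (struct_of_atoms A D)"
        unfolding S_def by blast
      have "\<not> substructure \<rho> \<BB> \<AA>" if "\<BB> \<in> \<psi>" for \<BB>
        using orbit_dnf[OF D(1)] that none unfolding D(2) substructure_iff_atoms by blast
      then show "{\<BB> \<in> \<psi>. substructure \<rho> \<BB> \<AA>} = {}"
        by simp
    qed
    also have "\<dots> \<longleftrightarrow> \<not> P \<AA>"
      using assms(6) that sat_iff_dnf_atoms[OF assms(4) fst_Struct[OF that]] by blast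
    finally show ?thesis
      unfolding subst_poly_sum_Var[OF \<open>finite S\<close>] by blast
  qed
  moreover have "iso_magnitude \<rho> \<psi> \<le> complexity \<rho> A \<Gamma>" if \<psi>: "\<psi> \<in> S" for \<psi>
  proof -
    obtain D where D: "D \<in> dnf \<rho> A \<Gamma>" "\<psi> = ?orb (struct_of_atoms A D)"
      using \<psi> by (auto simp: S_def)
    \<comment> \<open>\<open>iso_magnitude\<close> measures an arbitrary representative; by
      \<open>orbit_dnf\<close> its atoms form a disjunct, whose size is bounded by the maximum in
      \<open>complexity\<close>.\<close>
    have "(SOME \<BB>. \<BB> \<in> \<psi>) \<in> \<psi>"
      using orbit_self[OF D(1)] D(2) by (metis someI)
    then have atoms: "atoms (SOME \<BB>. \<BB> \<in> \<psi>) \<in> dnf \<rho> A \<Gamma>"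
      using orbit_dnf D by blast
    then have "iso_magnitude \<rho> \<psi> = card (atoms (SOME \<BB>. \<BB> \<in> \<psi>))"
      by (simp add: iso_magnitude_def magnitude_eq_card_atoms fin_disjunct)
    then show ?thesis
      using atoms fin by (auto simp: complexity_def)
  qed
  ultimately show ?thesis
    by (intro bexI[of _ "\<Sum>\<psi>\<in>S. Var \<psi>"])
      (simp_all add: vars_sum_Var[OF \<open>finite S\<close>] polys_over_def)
qed

end
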